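(* Let $(m_{k})_{k\ge 0}$ and $(n_{k'})_{k'\ge 0}$ be two strictly increasing sequences of integers. Let $\psi:\mathbb{N}\to\mathbb{N}$ be such that $\psi(k)\to+\infty$ as $k\to+\infty$, set $D_{\psi}=\{(k,k')\in\mathbb{N}^{2} : 0\le k'\le\psi(k)\}$, and suppose that the set $$C'_{\psi}=\{\lambda\in\mathbb{T} : \lambda^{m_{k}n_{k'}}\to 1 \text{ as } k\to+\infty,\ (k,k')\in D_{\psi}\}$$ is dense in $\mathbb{T}$. Then there exists a continuous probability measure $\mu$ on $\mathbb{T}$ such that $\widehat{\mu}(m_{k}n_{k'})\to 1$ as $k\to+\infty$ with $(k,k')\in D_{\psi}$.
   Context: $\mathbb{N}$ denotes the nonnegative integers and $\mathbb{T}=\{\lambda\in\mathbb{C} : |\lambda|=1\}$. For a finite complex Borel measure $\mu$ on $\mathbb{T}$ and $n\in\mathbb{Z}$, $\widehat{\mu}(n)=\int_{\mathbb{T}}\lambda^{n}\,d\mu(\lambda)$. A Borel probability measure $\mu$ on $\mathbb{T}$ is continuous if $\mu(\{\lambda\})=0$ for every $\lambda\in\mathbb{T}$. For a doubly indexed family $(z_{k,k'})_{k,k'\ge 0}$ of complex numbers, "$z_{k,k'}\to z$ as $k\to+\infty$ with $(k,k')\in D_{\psi}$" means: for every $\gamma>0$ there is an integer $k_{0}$ such that $|z_{k,k'}-z|<\gamma$ for every $(k,k')\in\mathbb{N}^2$ with $k\ge k_{0}$ and $0\le k'\le\psi(k)$. *)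

theory Defs
  imports "HOL-Probability.Probability"
begin

abbreviation unit_circle :: "complex set" where
  "unit_circle \<equiv> {z. cmod z = 1}"

definition D_set :: "(nat \<Rightarrow> nat) \<Rightarrow> (nat \<times> nat) set" where
  "D_set \<psi> = {(k, k'). k' \<le> \<psi> k}"

(* Only the first index tends to infinity; the second is constrained by the pair lying in D. *)
definition tendsto_along :: "(nat \<times> nat) set \<Rightarrow> (nat \<Rightarrow> nat \<Rightarrow> complex) \<Rightarrow> complex \<Rightarrow> bool" where
  "tendsto_along D z l \<longleftrightarrow>
     (\<forall>\<gamma>>0. \<exists>k0::nat. \<forall>k k'. (k, k') \<in> D \<and> k0 \<le> k \<longrightarrow> cmod (z k k' - l) < \<gamma>)"

definition C_set :: "(nat \<Rightarrow> int) \<Rightarrow> (nat \<Rightarrow> int) \<Rightarrow> (nat \<Rightarrow> nat) \<Rightarrow> complex set" where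
  "C_set m n \<psi> =
     {z \<in> unit_circle. tendsto_along (D_set \<psi>) (\<lambda>k k'. z powi (m k * n k')) 1}"

definition circle_prob_measure :: "complex measure \<Rightarrow> bool" where
  "circle_prob_measure \<mu> \<longleftrightarrow>
     prob_space \<mu> \<and> sets \<mu> = sets (restrict_space borel unit_circle)"

definition continuous_circle_measure :: "complex measure \<Rightarrow> bool" where
  "continuous_circle_measure \<mu> \<longleftrightarrow> (\<forall>z\<in>unit_circle. measure \<mu> {z} = 0)"

(* The exponent is i, not - i: this is the sign convention for Fourier coefficients used here. *)
definition fourier_coeff :: "complex measure \<Rightarrow> int \<Rightarrow> complex" where
  "fourier_coeff \<mu> i = (\<integral>z. z powi i \<partial>\<mu>)"

end

theory Submission
  imports Defs "HOL-Library.Discrete_Functions"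
begin

text \<open>The set \<open>C_set m n \<psi>\<close> is dense, so it contains points \<open>cis (\<theta> i)\<close> arbitrarily close to 1.
  Choosing them inductively and tending to 1 fast enough, one arranges that at every time \<open>k\<close> the
  numbers \<open>|cis (N * \<theta> i) - 1|\<close> with \<open>N\<close> in the finite set of exponents of index \<open>k\<close> have a small
  sum over all \<open>i\<close> except a single one, and this exceptional index tends to infinity with \<open>k\<close>.
  Let \<open>w\<close> be uniform in \<open>[1, 2)\<close>, let \<open>A i\<close> be a listing of the dyadic intervals, and let \<open>\<mu>\<close> be
  the law of \<open>cis (\<Sum>i. \<theta> i * 1_(A i)(w))\<close>. If \<open>i\<close> is the exceptional index, the Fourier coefficient
  at \<open>N\<close> differs from 1 by at most a small quantity plus twice the length of \<open>A i\<close>, which tends to 0.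
  Since the \<open>A i\<close> separate points and subset sums of \<open>\<theta>\<close> determine the subset (each term is at most
  a third of the preceding one), \<open>w\<close> is determined by its image, so \<open>\<mu>\<close> has no atoms.\<close>

section \<open>Rigid angles and their inductive selection\<close>

text \<open>When \<open>F k\<close> consists of the products \<open>m k * n k'\<close> with
  \<open>k' \<le> \<psi> k\<close>, this says that \<open>cis t\<close> lies in
  \<open>C_set m n \<psi>\<close>; the double index has become a limit in \<open>k\<close> that is
  uniform over a finite set.\<close>

definition rigid_angle :: "(nat \<Rightarrow> int set) \<Rightarrow> real \<Rightarrow> bool" where
  "rigid_angle F t \<longleftrightarrow>
     (\<forall>\<gamma>>0. \<exists>k0. \<forall>k\<ge>k0. \<forall>N\<in>F k. cmod (cis (of_int N * t) - 1) < \<gamma>)"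

lemma norm_cis_add_minus_one_le: "cmod (cis (a + b) - 1) \<le> cmod (cis a - 1) + cmod (cis b - 1)"
proof -
  have "cis (a + b) - 1 = cis a * (cis b - 1) + (cis a - 1)"
    by (simp add: cis_mult [symmetric] algebra_simps)
  also have "cmod \<dots> \<le> cmod (cis a * (cis b - 1)) + cmod (cis a - 1)"
    by (rule norm_triangle_ineq)
  finally show ?thesis
    by (simp add: norm_mult add.commute)
qed

lemma norm_cis_sum_minus_one_le:
  "finite S \<Longrightarrow> cmod (cis (\<Sum>j\<in>S. a j) - 1) \<le> (\<Sum>j\<in>S. cmod (cis (a j) - 1))"
  by (induction S rule: finite_induct) (auto intro: order_trans[OF norm_cis_add_minus_one_le])

lemma norm_cis_minus_minus_one: "cmod (cis (- x) - 1) = cmod (cis x - 1)"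
  by (metis cis_cnj complex_cnj_diff complex_cnj_one complex_mod_cnj)

text \<open>Finitely many rigid angles share one threshold. This supplies the time after which all
  the angles chosen so far are harmless together.\<close>

lemma sum_rigid_angles:
  assumes "finite S" "\<And>j. j \<in> S \<Longrightarrow> rigid_angle F (\<theta> j)" "\<gamma> > 0"
  shows "\<exists>k0. \<forall>k\<ge>k0. \<forall>N\<in>F k. (\<Sum>j\<in>S. cmod (cis (of_int N * \<theta> j) - 1)) \<le> \<gamma>"
  using assms
proof (induction S arbitrary: \<gamma> rule: finite_induct)
  case empty
  then show ?case by auto
next
  case (insert x S)
  obtain k1 where k1: "\<forall>k\<ge>k1. \<forall>N\<in>F k. (\<Sum>j\<in>S. cmod (cis (of_int N * \<theta> j) - 1)) \<le> \<gamma> / 2"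
    using insert.IH[of "\<gamma> / 2"] insert.prems by auto
  obtain k2 where k2: "\<forall>k\<ge>k2. \<forall>N\<in>F k. cmod (cis (of_int N * \<theta> x) - 1) < \<gamma> / 2"
    using insert.prems unfolding rigid_angle_def by (meson half_gt_zero insertI1)
  show ?case
  proof (intro exI[of _ "max k1 k2"] allI impI ballI)
    fix k N assume "max k1 k2 \<le> k" "N \<in> F k"
    then show "(\<Sum>j\<in>insert x S. cmod (cis (of_int N * \<theta> j) - 1)) \<le> \<gamma>"
      using k1[rule_format, of k N] k2[rule_format, of k N] insert.hyps by simp
  qed
qed

text \<open>Angles and times are chosen alternately. \<open>\<theta> i\<close> is taken so small
  that the finitely many exponents of times up to the earlier \<open>K j\<close> barely move it;
  then \<open>K i\<close> is taken so late that rigidity controls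
  \<open>\<theta> 0, ..., \<theta> i\<close> from there on.\<close>

lemma exists_rigid_angle_sequence:
  assumes fin: "\<And>k. finite (F k)" and freq: "\<exists>\<^sub>F t in at_right 0. rigid_angle F t"
  obtains \<theta> :: "nat \<Rightarrow> real" and K :: "nat \<Rightarrow> nat" where
    "\<And>i. 0 < \<theta> i" "\<And>i. \<theta> i \<le> (1/3) ^ i" "\<And>i j. j < i \<Longrightarrow> \<theta> i \<le> \<theta> j * (1/3) ^ (i - j)"
    "strict_mono K"
    "\<And>i j k N. j < i \<Longrightarrow> k \<le> K j \<Longrightarrow> N \<in> F k \<Longrightarrow> cmod (cis (of_int N * \<theta> i) - 1) \<le> (1/2) ^ i"
    "\<And>i k N. K i \<le> k \<Longrightarrow> N \<in> F k \<Longrightarrow> (\<Sum>j\<le>i. cmod (cis (of_int N * \<theta> j) - 1)) \<le> (1/2) ^ i"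
proof -
  \<comment> \<open>A pair \<open>p\<close> holds an angle and a time. \<open>P f i\<close> reads
    \<open>f\<close> only below \<open>i\<close>, so the term of the new angle is kept apart from
    the sum; dependent choice needs this.\<close>
  define P where "P f i p \<longleftrightarrow> rigid_angle F (fst p) \<and> 0 < fst p \<and> fst p \<le> (1/3) ^ i \<and>
      (\<forall>j<i. fst p \<le> fst (f j) * (1/3) ^ (i - j)) \<and> (\<forall>j<i. snd (f j) < snd p) \<and>
      (\<forall>j<i. \<forall>k\<le>snd (f j). \<forall>N\<in>F k. cmod (cis (of_int N * fst p) - 1) \<le> (1/2) ^ i) \<and>
      (\<forall>k\<ge>snd p. \<forall>N\<in>F k. cmod (cis (of_int N * fst p) - 1) +
          (\<Sum>j<i. cmod (cis (of_int N * fst (f j)) - 1)) \<le> (1/2) ^ i)"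
    for f :: "nat \<Rightarrow> real \<times> nat" and i and p
  have "\<exists>f. \<forall>i. P f i (f i)"
  proof (rule dependent_wellorder_choice)
    fix p :: "real \<times> nat" and f g :: "nat \<Rightarrow> real \<times> nat" and i :: nat
    assume "\<And>j. j < i \<Longrightarrow> f j = g j"
    then show "P f i p = P g i p"
      by (simp add: P_def cong: conj_cong)
  next
    fix i and f :: "nat \<Rightarrow> real \<times> nat"
    assume f: "\<And>j. j < i \<Longrightarrow> P f j (f j)"
    have pos: "0 < fst (f j)" if "j < i" for j
      using f[OF that] by (simp add: P_def)
    have ev_le: "\<forall>\<^sub>F t in at_right 0. t \<le> c" if "c > 0" for c :: real
      using that by (intro eventually_at_rightI[of 0 c]) auto
    have ev_cis: "\<forall>\<^sub>F t in at_right 0. cmod (cis (of_int N * t) - 1) \<le> c" if "c > 0" for c and N :: int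
    proof -
      have "((\<lambda>t. cmod (cis (of_int N * t) - 1)) \<longlongrightarrow> cmod (cis (of_int N * 0) - 1)) (at_right 0)"
        by (intro tendsto_intros)
      then have "\<forall>\<^sub>F t in at_right 0. cmod (cis (of_int N * t) - 1) < c"
        using that by (intro order_tendstoD) auto
      then show ?thesis by (rule eventually_mono) simp
    qed
    \<comment> \<open>Every demand on the new angle except rigidity is a finite conjunction of
      conditions valid near 0, so it holds eventually and can be met together with rigidity, which
      holds frequently.\<close>
    let ?Q = "\<lambda>t. 0 < t \<and> t \<le> (1/3) ^ i \<and>
      (\<forall>j\<in>{..<i}. t \<le> fst (f j) * (1/3) ^ (i - j)) \<and>
      (\<forall>j\<in>{..<i}. \<forall>k\<in>{..snd (f j)}. \<forall>N\<in>F k. cmod (cis (of_int N * t) - 1) \<le> (1/2) ^ i)"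
    have "\<forall>\<^sub>F t in at_right 0. ?Q t"
      by (intro eventually_conj eventually_ball_finite ballI ev_le ev_cis fin)
        (auto simp: eventually_at_right_less pos)
    from frequently_ex[OF frequently_eventually_conj[OF freq this]]
    obtain t where "?Q t" and t1: "rigid_angle F t"
      by blast
    then have t: "0 < t" "t \<le> (1/3) ^ i"
      "\<And>j. j < i \<Longrightarrow> t \<le> fst (f j) * (1/3) ^ (i - j)"
      "\<And>j k N. j < i \<Longrightarrow> k \<le> snd (f j) \<Longrightarrow> N \<in> F k \<Longrightarrow> cmod (cis (of_int N * t) - 1) \<le> (1/2) ^ i"
      by auto
    define \<theta> where "\<theta> j = (if j < i then fst (f j) else t)" for j
    have "rigid_angle F (\<theta> j)" for j
      using f[of j] t1 by (simp add: \<theta>_def P_def)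
    then obtain k0 where k0:
        "\<forall>k\<ge>k0. \<forall>N\<in>F k. (\<Sum>j\<le>i. cmod (cis (of_int N * \<theta> j) - 1)) \<le> (1/2) ^ i"
      using sum_rigid_angles[of "{..i}" F \<theta> "(1/2) ^ i"] by auto
    have eq: "(\<Sum>j\<le>i. cmod (cis (of_int N * \<theta> j) - 1)) =
        cmod (cis (of_int N * t) - 1) + (\<Sum>j<i. cmod (cis (of_int N * fst (f j)) - 1))" for N
      by (simp add: \<theta>_def lessThan_Suc_atMost [symmetric])
    \<comment> \<open>Passing \<open>k0\<close> gives the bound on the sum; the \<open>Suc\<close>
      makes the times strictly increasing.\<close>
    define K where "K = Max (insert k0 ((\<lambda>j. Suc (snd (f j))) ` {..<i}))"
    have "k0 \<le> K" and K: "\<And>j. j < i \<Longrightarrow> Suc (snd (f j)) \<le> K"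
      unfolding K_def by (auto intro: Max_ge)
    have "\<forall>k\<ge>K. \<forall>N\<in>F k. (\<Sum>j\<le>i. cmod (cis (of_int N * \<theta> j) - 1)) \<le> (1/2) ^ i"
      using k0 \<open>k0 \<le> K\<close> order_trans by blast
    then have "P f i (t, K)"
      using t t1 K by (auto simp: P_def Suc_le_eq eq)
    then show "\<exists>p. P f i p" ..
  qed
  then obtain f where f: "\<And>i. P f i (f i)" by blast
  show thesis
  proof (rule that[of "fst \<circ> f" "snd \<circ> f"])
    show "strict_mono (snd \<circ> f)"
      using f by (auto simp: strict_mono_def P_def)
    show "(\<Sum>j\<le>i. cmod (cis (of_int N * (fst \<circ> f) j) - 1)) \<le> (1/2) ^ i"
      if "(snd \<circ> f) i \<le> k" "N \<in> F k" for i k N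
      using f[of i] that by (simp add: P_def lessThan_Suc_atMost [symmetric] add.commute)
  qed (use f in \<open>auto simp: P_def\<close>)
qed

text \<open>If \<open>K h \<le> k < K (Suc h)\<close>, the angles up to \<open>h\<close> are
  controlled because \<open>k\<close> is late for them, and those beyond \<open>Suc h\<close>
  because they were chosen small for time \<open>k\<close>. Only the index \<open>Suc h\<close>
  escapes.\<close>

lemma exists_almost_rigid_angles:
  assumes "\<And>k. finite (F k)" and "\<exists>\<^sub>F t in at_right 0. rigid_angle F t"
  obtains \<theta> :: "nat \<Rightarrow> real" where
    "\<And>i. 0 < \<theta> i" "\<And>i. \<theta> i \<le> (1/3) ^ i" "\<And>i j. j < i \<Longrightarrow> \<theta> i \<le> \<theta> j * (1/3) ^ (i - j)"
    "\<And>I \<gamma>. \<gamma> > 0 \<Longrightarrow> \<exists>k0. \<forall>k\<ge>k0. \<exists>i\<ge>I. \<forall>N\<in>F k. \<forall>S. finite S \<longrightarrow> i \<notin> S \<longrightarrow>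
       (\<Sum>j\<in>S. cmod (cis (of_int N * \<theta> j) - 1)) \<le> \<gamma>"
proof -
  obtain \<theta> :: "nat \<Rightarrow> real" and K :: "nat \<Rightarrow> nat" where *:
    "\<And>i. 0 < \<theta> i" "\<And>i. \<theta> i \<le> (1/3) ^ i" "\<And>i j. j < i \<Longrightarrow> \<theta> i \<le> \<theta> j * (1/3) ^ (i - j)"
    and K: "strict_mono K"
    and below: "\<And>i j k N. j < i \<Longrightarrow> k \<le> K j \<Longrightarrow> N \<in> F k \<Longrightarrow> cmod (cis (of_int N * \<theta> i) - 1) \<le> (1/2) ^ i"
    and above: "\<And>i k N. K i \<le> k \<Longrightarrow> N \<in> F k \<Longrightarrow> (\<Sum>j\<le>i. cmod (cis (of_int N * \<theta> j) - 1)) \<le> (1/2) ^ i"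
    using exists_rigid_angle_sequence[OF assms] by metis
  show thesis
  proof (rule that[of \<theta>])
    fix I :: nat and \<gamma> :: real
    assume "\<gamma> > 0"
    \<comment> \<open>The factor 2 accounts for the indices below and the indices above the
      exceptional one, each group contributing at most \<open>(1/2) ^ h\<close>.\<close>
    have "(\<lambda>i. 2 * (1/2::real) ^ i) \<longlonglongrightarrow> 2 * 0"
      by (intro tendsto_intros LIMSEQ_abs_realpow_zero2) auto
    then have "\<forall>\<^sub>F i in sequentially. 2 * (1/2::real) ^ i < \<gamma>"
      using \<open>\<gamma> > 0\<close> by (intro order_tendstoD) auto
    then obtain J where J: "\<And>i. J \<le> i \<Longrightarrow> 2 * (1/2::real) ^ i < \<gamma>"
      unfolding eventually_sequentially by blast
    show "\<exists>k0. \<forall>k\<ge>k0. \<exists>i\<ge>I. \<forall>N\<in>F k. \<forall>S. finite S \<longrightarrow> i \<notin> S \<longrightarrow>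
       (\<Sum>j\<in>S. cmod (cis (of_int N * \<theta> j) - 1)) \<le> \<gamma>"
    proof (rule exI[of _ "K (max I J)"], intro allI impI)
      fix k assume k: "K (max I J) \<le> k"
      define i where "i = (LEAST i. k < K i)"
      have "k < K (Suc k)"
        using strict_mono_imp_increasing[OF K, of "Suc k"] by simp
      then have i: "k < K i"
        unfolding i_def by (rule LeastI)
      have "K (max I J) < K i"
        using k i by simp
      then have "max I J < i"
        using K by (simp add: strict_mono_less)
      \<comment> \<open>Since \<open>i\<close> is positive it has a predecessor \<open>h\<close>,
        and minimality of \<open>i\<close> places \<open>k\<close> between \<open>K h\<close> and
        \<open>K i\<close>.\<close>
      then obtain h where h: "i = Suc h" "I \<le> h" "J \<le> h"
        by (cases i) auto
      have "K h \<le> k"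
        using not_less_Least[of h "\<lambda>i. k < K i"] h by (simp add: i_def [symmetric])
      show "\<exists>i\<ge>I. \<forall>N\<in>F k. \<forall>S. finite S \<longrightarrow> i \<notin> S \<longrightarrow>
          (\<Sum>j\<in>S. cmod (cis (of_int N * \<theta> j) - 1)) \<le> \<gamma>"
      proof (intro exI[of _ i] conjI ballI allI impI)
        show "I \<le> i" using h by simp
        fix N and S :: "nat set"
        assume N: "N \<in> F k" and S: "finite S" "i \<notin> S"
        let ?a = "\<lambda>j. cmod (cis (of_int N * \<theta> j) - 1)"
        have "sum ?a (S \<inter> {..h}) \<le> sum ?a {..h}"
          by (rule sum_mono2) auto
        also have "\<dots> \<le> (1/2) ^ h"
          using above[OF \<open>K h \<le> k\<close> N] .
        finally have 1: "sum ?a (S \<inter> {..h}) \<le> (1/2) ^ h" .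
        have "sum ?a (S - {..h}) \<le> (\<Sum>j\<in>S - {..h}. (1/2) ^ j)"
        proof (rule sum_mono)
          fix j assume "j \<in> S - {..h}"
          then have "i < j"
            using S(2) h(1) by (cases "j = i") auto
          then show "?a j \<le> (1/2) ^ j"
            using below[of i j k N] i N by simp
        qed
        also have "\<dots> \<le> (\<Sum>j. (1/2) ^ (j + Suc h))"
        proof -
          \<comment> \<open>Shifting the indices turns the finite sum into part of a full geometric
            series; the truncated subtraction is exact because every \<open>j\<close> here exceeds
            \<open>h\<close>.\<close>
          have "(\<Sum>j\<in>S - {..h}. (1/2::real) ^ j) = (\<Sum>j\<in>(\<lambda>j. j - Suc h) ` (S - {..h}). (1/2) ^ (j + Suc h))"
          proof (subst sum.reindex)
            show "inj_on (\<lambda>j. j - Suc h) (S - {..h})" by (auto intro!: inj_onI)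
            show "(\<Sum>j\<in>S - {..h}. (1/2::real) ^ j) =
                sum ((\<lambda>j. (1/2) ^ (j + Suc h)) \<circ> (\<lambda>j. j - Suc h)) (S - {..h})"
            proof (rule sum.cong)
              fix j assume "j \<in> S - {..h}"
              then have "j - Suc h + Suc h = j" by simp
              then show "(1/2::real) ^ j = ((\<lambda>j. (1/2) ^ (j + Suc h)) \<circ> (\<lambda>j. j - Suc h)) j"
                unfolding o_def by presburger
            qed simp
          qed
          also have "\<dots> \<le> (\<Sum>j. (1/2) ^ (j + Suc h))"
            using S(1) by (intro sum_le_suminf) (auto simp: power_add intro!: summable_mult2 summable_geometric)
          finally show ?thesis .
        qed
        also have "\<dots> = (1/2) ^ h"
        proof -
          have "(\<lambda>j. (1/2) ^ j * (1/2::real) ^ Suc h) sums (1 / (1 - 1/2) * (1/2) ^ Suc h)"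
            by (intro sums_mult2 geometric_sums) auto
          then show ?thesis
            by (simp only: power_add [symmetric] sums_iff) simp
        qed
        finally have "sum ?a (S - {..h}) \<le> (1/2) ^ h" .
        then have "sum ?a S \<le> 2 * (1/2) ^ h"
          using 1 sum.Int_Diff[OF S(1), of ?a "{..h}"] by simp
        then show "sum ?a S \<le> \<gamma>"
          using J[OF h(3)] by simp
      qed
    qed
  qed (use * in auto)
qed

section \<open>Small rigid angles from density\<close>

text \<open>Density gives points of \<open>C_set m n \<psi>\<close> near 1 but different from 1; the
  absolute values of their arguments are small positive rigid angles.\<close>

lemma frequently_rigid_angle:
  assumes dense: "unit_circle \<subseteq> closure (C_set m n \<psi>)"
  shows "\<exists>\<^sub>F t in at_right 0. rigid_angle (\<lambda>k. (\<lambda>k'. m k * n k') ` {..\<psi> k}) t"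
proof -
  let ?F = "\<lambda>k. (\<lambda>k'. m k * n k') ` {..\<psi> k}"
  have "\<exists>t. 0 < t \<and> t < \<delta> \<and> rigid_angle ?F t" if "\<delta> > 0" for \<delta> :: real
  proof -
    have "isCont Arg 1"
      by (rule continuous_at_Arg) auto
    then have "\<exists>\<epsilon>>0. \<forall>z. dist z 1 < \<epsilon> \<longrightarrow> dist (Arg z) (Arg 1) < \<delta>"
      using that unfolding continuous_at_eps_delta by blast
    then obtain \<epsilon> where \<epsilon>: "\<epsilon> > 0" "\<And>z. dist z 1 < \<epsilon> \<Longrightarrow> \<bar>Arg z\<bar> < \<delta>"
      by (auto simp: dist_real_def)
    have "((\<lambda>t. cmod (cis t - 1)) \<longlongrightarrow> cmod (cis 0 - 1)) (at_right 0)"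
      by (intro tendsto_intros)
    then have "\<forall>\<^sub>F t in at_right 0. cmod (cis t - 1) < \<epsilon> / 2"
      using \<epsilon> by (intro order_tendstoD) auto
    moreover have "\<forall>\<^sub>F t in at_right (0::real). 0 < t \<and> t < pi"
      by (intro eventually_at_rightI[of 0 pi]) auto
    ultimately have "\<forall>\<^sub>F t in at_right 0. cmod (cis t - 1) < \<epsilon> / 2 \<and> 0 < t \<and> t < pi"
      by eventually_elim auto
    then obtain t where t: "cmod (cis t - 1) < \<epsilon> / 2" "0 < t" "t < pi"
      using eventually_happens'[OF trivial_limit_at_right_real] by blast
    have "cis t \<noteq> 1"
      using sin_gt_zero[OF t(2,3)] by (auto simp: complex_eq_iff)
    then have pos: "cmod (cis t - 1) > 0" by simp
    \<comment> \<open>Approximating \<open>cis t\<close> within its own distance to 1 excludes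
      \<open>z = 1\<close>, and since that distance is below \<open>\<epsilon> / 2\<close>,
      \<open>z\<close> stays within \<open>\<epsilon>\<close> of 1.\<close>
    have "cis t \<in> closure (C_set m n \<psi>)"
      using dense by auto
    then obtain z where z: "z \<in> C_set m n \<psi>" "dist z (cis t) < cmod (cis t - 1)"
      using pos unfolding closure_approachable by blast
    have [simp]: "cmod z = 1"
      using z by (simp add: C_set_def)
    have "z \<noteq> 1"
      using z(2) by (auto simp: dist_norm norm_minus_commute)
    have cisz: "cis (Arg z) = z"
      by (metis \<open>cmod z = 1\<close> mult_1 of_real_1 rcis_cmod_Arg rcis_def)
    have "Arg z \<noteq> 0"
      using cisz \<open>z \<noteq> 1\<close> by force
    have "dist z 1 < \<epsilon>"
      using z(2) t(1) dist_triangle[of z 1 "cis t"] by (simp add: dist_norm)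
    then have "\<bar>Arg z\<bar> < \<delta>" by (rule \<epsilon>)
    \<comment> \<open>The argument may be negative; conjugation preserves the distance to 1, so its
      absolute value serves equally well.\<close>
    have eq: "cmod (cis (of_int N * \<bar>Arg z\<bar>) - 1) = cmod (z powi N - 1)" for N
    proof -
      have "z powi N = cis (of_int N * Arg z)"
        by (subst cisz [symmetric]) (rule cis_power_int)
      then show ?thesis
        using norm_cis_minus_minus_one[of "of_int N * Arg z"] by (auto simp: abs_if)
    qed
    have "rigid_angle ?F \<bar>Arg z\<bar>"
      using z(1) unfolding rigid_angle_def C_set_def tendsto_along_def D_set_def eq by fastforce
    then show ?thesis
      using \<open>\<bar>Arg z\<bar> < \<delta>\<close> \<open>Arg z \<noteq> 0\<close> by (intro exI[of _ "\<bar>Arg z\<bar>"]) auto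
  qed
  then show ?thesis
    unfolding frequently_def eventually_at_right_field by (metis)
qed

section \<open>Subset sums of rapidly decreasing angles\<close>

definition subsum :: "(nat \<Rightarrow> real) \<Rightarrow> nat set \<Rightarrow> real" where
  "subsum \<theta> E = (\<Sum>i. indicat_real E i * \<theta> i)"

lemma summable_subsum:
  assumes "\<And>i. 0 \<le> \<theta> i" "summable \<theta>"
  shows "summable (\<lambda>i. indicat_real E i * \<theta> i)"
  by (rule summable_comparison_test'[OF assms(2), of 0]) (simp add: indicator_def assms(1))

text \<open>The terms after \<open>j\<close> sum to at most
  \<open>\<theta> j * (1/3 + 1/9 + ...) = \<theta> j / 2\<close>, so they cannot make up for a
  missing \<open>\<theta> j\<close>: subset sums are ordered lexicographically.\<close>

lemma subsum_less_of_first_difference: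
  assumes \<theta>: "\<And>i. 0 < \<theta> i" "summable \<theta>" "\<And>i j. j < i \<Longrightarrow> \<theta> i \<le> \<theta> j * (1/3) ^ (i - j)"
    and eq: "\<And>i. i < j \<Longrightarrow> i \<in> E \<longleftrightarrow> i \<in> E'" and j: "j \<in> E" "j \<notin> E'"
  shows "subsum \<theta> E' < subsum \<theta> E"
proof -
  have sm: "summable (\<lambda>i. indicat_real X i * \<theta> i)" for X
    using \<theta> by (intro summable_subsum) (auto intro: less_imp_le)
  have split: "subsum \<theta> X = (\<Sum>i. indicat_real X (i + Suc j) * \<theta> (i + Suc j)) + indicat_real X j * \<theta> j +
      (\<Sum>i<j. indicat_real X i * \<theta> i)" for X
    unfolding subsum_def by (subst suminf_split_initial_segment[OF sm, of _ "Suc j"]) simp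
  have geo: "(\<lambda>i. \<theta> j * (1/3) * (1/3) ^ i) sums (\<theta> j * (1/3) * (1 / (1 - 1/3)))"
    by (intro sums_mult geometric_sums) auto
  have "(\<Sum>i. indicat_real E' (i + Suc j) * \<theta> (i + Suc j)) \<le> (\<Sum>i. \<theta> j * (1/3) * (1/3) ^ i)"
  proof (rule suminf_le)
    show "summable (\<lambda>i. indicat_real E' (i + Suc j) * \<theta> (i + Suc j))"
      by (intro summable_ignore_initial_segment sm)
    show "summable (\<lambda>i. \<theta> j * (1/3) * (1/3) ^ i)"
      using geo by (rule sums_summable)
    fix i
    have "\<theta> (i + Suc j) \<le> \<theta> j * (1/3) * (1/3) ^ i"
      using \<theta>(3)[of j "i + Suc j"] by simp
    moreover have "0 \<le> \<theta> j * (1/3) * (1/3) ^ i"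
      using \<theta>(1)[of j] by simp
    ultimately show "indicat_real E' (i + Suc j) * \<theta> (i + Suc j) \<le> \<theta> j * (1/3) * (1/3) ^ i"
      by (auto simp: indicator_def)
  qed
  also have "\<dots> = \<theta> j / 2"
    using sums_unique[OF geo] by simp
  also have "\<dots> < \<theta> j"
    using \<theta>(1)[of j] by simp
  finally have "(\<Sum>i. indicat_real E' (i + Suc j) * \<theta> (i + Suc j)) < \<theta> j" .
  moreover have "0 \<le> (\<Sum>i. indicat_real E (i + Suc j) * \<theta> (i + Suc j))"
    using \<theta>(1) by (intro suminf_nonneg summable_ignore_initial_segment sm) (simp add: less_imp_le)
  moreover have "(\<Sum>i<j. indicat_real E i * \<theta> i) = (\<Sum>i<j. indicat_real E' i * \<theta> i)"
    using eq by (intro sum.cong) (auto simp: indicator_def)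
  ultimately show ?thesis
    using j by (simp add: split)
qed

lemma inj_subsum:
  assumes \<theta>: "\<And>i. 0 < \<theta> i" "summable \<theta>" "\<And>i j. j < i \<Longrightarrow> \<theta> i \<le> \<theta> j * (1/3) ^ (i - j)"
  shows "inj (subsum \<theta>)"
proof (rule injI, rule ccontr)
  fix E E' assume *: "subsum \<theta> E = subsum \<theta> E'" "E \<noteq> E'"
  define j where "j = (LEAST j. \<not> (j \<in> E \<longleftrightarrow> j \<in> E'))"
  have "\<exists>j. \<not> (j \<in> E \<longleftrightarrow> j \<in> E')"
    using * by auto
  then have "\<not> (j \<in> E \<longleftrightarrow> j \<in> E')"
    unfolding j_def by (rule LeastI_ex)
  moreover have "i \<in> E \<longleftrightarrow> i \<in> E'" if "i < j" for i
    using not_less_Least that unfolding j_def by blast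
  ultimately show False
    using subsum_less_of_first_difference[OF \<theta>, of j E E']
      subsum_less_of_first_difference[OF \<theta>, of j E' E] * by auto
qed

lemma subsum_bounds:
  assumes "\<And>i. 0 < \<theta> i" "\<And>i. \<theta> i \<le> (1/3) ^ i"
  shows "summable \<theta>" "subsum \<theta> E \<in> {0..3/2}"
proof -
  have geo: "(\<lambda>i. (1/3::real) ^ i) sums (1 / (1 - 1/3))"
    by (intro geometric_sums) auto
  show "summable \<theta>"
    by (rule summable_comparison_test'[OF sums_summable[OF geo], of 0])
      (use assms in \<open>auto simp: less_imp_le abs_of_pos\<close>)
  then have sm: "summable (\<lambda>i. indicat_real E i * \<theta> i)"
    using assms by (intro summable_subsum) (auto intro: less_imp_le)
  have "subsum \<theta> E \<le> (\<Sum>i. (1/3) ^ i)"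
    unfolding subsum_def using assms
    by (intro suminf_le sm sums_summable[OF geo]) (auto simp: indicator_def)
  moreover have "0 \<le> subsum \<theta> E"
    unfolding subsum_def using assms by (intro suminf_nonneg sm) (auto simp: less_imp_le)
  ultimately show "subsum \<theta> E \<in> {0..3/2}"
    using sums_unique[OF geo] by simp
qed

text \<open>Subadditivity bounds each partial sum, and the bound passes to the limit by continuity
  of \<open>cis\<close>.\<close>

lemma norm_cis_subsum_minus_one_le:
  assumes "\<And>i. 0 \<le> \<theta> i" "summable \<theta>"
    and bound: "\<And>S. finite S \<Longrightarrow> S \<subseteq> E \<Longrightarrow> (\<Sum>j\<in>S. cmod (cis (c * \<theta> j) - 1)) \<le> \<gamma>"
  shows "cmod (cis (c * subsum \<theta> E) - 1) \<le> \<gamma>"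
proof (rule tendsto_upperbound)
  show "(\<lambda>n. cmod (cis (c * (\<Sum>i<n. indicat_real E i * \<theta> i)) - 1))
      \<longlonglongrightarrow> cmod (cis (c * subsum \<theta> E) - 1)"
    unfolding subsum_def
    by (intro tendsto_intros summable_LIMSEQ summable_subsum assms)
  show "\<forall>\<^sub>F n in sequentially. cmod (cis (c * (\<Sum>i<n. indicat_real E i * \<theta> i)) - 1) \<le> \<gamma>"
  proof (intro always_eventually allI)
    fix n
    have "(\<Sum>i<n. indicat_real E i * \<theta> i) = sum \<theta> ({..<n} \<inter> E)"
      unfolding sum.inter_restrict[OF finite_lessThan] by (rule sum.cong) (auto simp: indicator_def)
    then have "cmod (cis (c * (\<Sum>i<n. indicat_real E i * \<theta> i)) - 1)
        \<le> (\<Sum>j\<in>{..<n} \<inter> E. cmod (cis (c * \<theta> j) - 1))"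
      using norm_cis_sum_minus_one_le[of "{..<n} \<inter> E" "\<lambda>j. c * \<theta> j"] by (simp add: sum_distrib_left)
    also have "\<dots> \<le> \<gamma>"
      by (rule bound) auto
    finally show "cmod (cis (c * (\<Sum>i<n. indicat_real E i * \<theta> i)) - 1) \<le> \<gamma>" .
  qed
qed simp

text \<open>The interval contains all the subset sums, as \<open>3/2\<close> is the sum of the
  powers of \<open>1/3\<close>. It lies inside \<open>[0, pi]\<close>, where the cosine alone is
  injective.\<close>

lemma inj_on_cis_subset: "inj_on cis {0..3/2}"
proof (rule inj_onI)
  fix x y :: real assume *: "x \<in> {0..3/2}" "y \<in> {0..3/2}" "cis x = cis y"
  then have "cos x = cos y" by (simp add: complex_eq_iff)
  then show "x = y"
    using * pi_gt3 cos_inj_pi[of x y] by simp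
qed

section \<open>Dyadic intervals of \<open>[1, 2)\<close>\<close>

text \<open>For \<open>2\<^sup>p \<le> i < 2\<^sup>p\<^sup>+\<^sup>1\<close> this is the dyadic interval \<open>[i / 2\<^sup>p, (i + 1) / 2\<^sup>p)\<close> of \<open>[1, 2)\<close>:
  its length tends to 0 as \<open>i\<close> grows.\<close>

definition dyadic :: "nat \<Rightarrow> real set" where
  "dyadic i = {w. \<lfloor>2 ^ floor_log i * w\<rfloor> = int i}"

lemma dyadic_eq: "dyadic i = {real i / 2 ^ floor_log i..<(real i + 1) / 2 ^ floor_log i}"
  by (auto simp: dyadic_def floor_eq_iff field_simps)

lemma dyadic_separates:
  assumes w: "w \<in> {1..<2}" and "w \<noteq> v"
  shows "\<exists>i. w \<in> dyadic i \<and> v \<notin> dyadic i"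
proof -
  \<comment> \<open>At a level \<open>p\<close> whose intervals are shorter than the distance of
    \<open>w\<close> and \<open>v\<close>, the two points cannot share an interval.\<close>
  obtain p where p: "1 / \<bar>w - v\<bar> < 2 ^ p"
    using real_arch_pow[of 2] by auto
  then have far: "1 < \<bar>2 ^ p * w - 2 ^ p * v\<bar>"
    using assms(2) unfolding right_diff_distrib [symmetric] abs_mult by (simp add: field_simps)
  define i where "i = nat \<lfloor>2 ^ p * w\<rfloor>"
  have "0 \<le> \<lfloor>2 ^ p * w\<rfloor>"
    using w by simp
  then have i: "\<lfloor>2 ^ p * w\<rfloor> = int i"
    by (simp add: i_def)
  \<comment> \<open>From \<open>1 \<le> w < 2\<close> it follows that
    \<open>2 ^ p \<le> i < 2 * 2 ^ p\<close>, so the level encoded in the index \<open>i\<close> is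
    exactly \<open>p\<close>.\<close>
  have "2 ^ p * 1 \<le> 2 ^ p * w" "2 ^ p * w < 2 ^ p * (2::real)"
    using w by (intro mult_left_mono mult_strict_left_mono; simp)+
  moreover have "real i \<le> 2 ^ p * w" "2 ^ p * w < real i + 1"
    using i by (simp_all add: floor_eq_iff)
  ultimately have "2 ^ p < real i + 1" "real i < 2 * 2 ^ p"
    by linarith+
  then have "real (2 ^ p) < real (Suc i)" "real i < real (2 * 2 ^ p)"
    by simp_all
  then have "2 ^ p \<le> i" "i < 2 * 2 ^ p"
    unfolding of_nat_less_iff by simp_all
  then have "floor_log i = p"
    by (intro floor_log_eqI) (auto intro: less_le_trans)
  moreover have "\<lfloor>2 ^ p * v\<rfloor> \<noteq> int i"
    using far i by linarith
  ultimately show ?thesis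
    using i by (auto simp: dyadic_def)
qed

lemma measure_dyadic_tendsto_0: "(\<lambda>i. measure lborel (dyadic i)) \<longlonglongrightarrow> 0"
proof -
  have "filterlim floor_log at_top sequentially"
  proof (rule filterlim_at_top[THEN iffD2], intro allI)
    fix p show "\<forall>\<^sub>F i in sequentially. p \<le> floor_log i"
      using floor_log_le_iff[of "2 ^ p"] by (auto simp: eventually_sequentially intro!: exI[of _ "2 ^ p"])
  qed
  then have "(\<lambda>i. (1/2::real) ^ floor_log i) \<longlonglongrightarrow> 0"
    by (rule filterlim_compose[rotated]) (simp add: LIMSEQ_abs_realpow_zero2)
  moreover have "measure lborel (dyadic i) = (1/2) ^ floor_log i" for i
    by (simp add: dyadic_eq field_simps)
  ultimately show ?thesis by simp
qed

section \<open>The measure, its continuity and its Fourier coefficients\<close>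

text \<open>As \<open>floor_log 0 = 0\<close>, index 0 stands for \<open>[0, 1)\<close>, so
  \<open>\<theta> 0\<close> never contributes when \<open>w\<close> is in
  \<open>[1, 2)\<close>.\<close>

definition rigid_point :: "(nat \<Rightarrow> real) \<Rightarrow> real \<Rightarrow> complex" where
  "rigid_point \<theta> w = cis (subsum \<theta> {i. w \<in> dyadic i})"

definition rigid_measure :: "(nat \<Rightarrow> real) \<Rightarrow> complex measure" where
  "rigid_measure \<theta> = distr (restrict_space lborel {1..<2}) (restrict_space borel unit_circle) (rigid_point \<theta>)"

lemma measurable_rigid_point:
  "rigid_point \<theta> \<in> restrict_space lborel {1..<2} \<rightarrow>\<^sub>M restrict_space borel unit_circle"
proof (rule measurable_restrict_space2)
  have [measurable]: "dyadic i \<in> sets borel" for i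
    by (simp add: dyadic_eq)
  have "subsum \<theta> {i. w \<in> dyadic i} = (\<Sum>i. indicat_real (dyadic i) w * \<theta> i)" for w
    unfolding subsum_def by (simp add: indicator_def)
  then have "(\<lambda>w. subsum \<theta> {i. w \<in> dyadic i}) \<in> borel_measurable borel"
    by simp
  moreover have "cis \<in> borel_measurable borel"
    by (intro borel_measurable_continuous_onI continuous_intros)
  ultimately have "rigid_point \<theta> \<in> borel_measurable borel"
    unfolding rigid_point_def by (rule measurable_compose)
  then show "rigid_point \<theta> \<in> borel_measurable (restrict_space lborel {1..<2})"
    by (intro measurable_restrict_space1) simp
qed (simp add: rigid_point_def)

lemma prob_space_uniform: "prob_space (restrict_space lborel {1..<2::real})"
  by (intro prob_space_restrict_space) auto

lemma circle_prob_measure_rigid_measure: "circle_prob_measure (rigid_measure \<theta>)"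
  unfolding circle_prob_measure_def rigid_measure_def
  by (auto intro!: prob_space.prob_space_distr prob_space_uniform measurable_rigid_point)

text \<open>Three injectivities are chained: \<open>cis\<close> recovers the subset sum, the sum
  recovers the set of indices, and the dyadic intervals containing \<open>w\<close> recover
  \<open>w\<close>.\<close>

lemma inj_on_rigid_point:
  assumes "\<And>i. 0 < \<theta> i" "\<And>i. \<theta> i \<le> (1/3) ^ i" "\<And>i j. j < i \<Longrightarrow> \<theta> i \<le> \<theta> j * (1/3) ^ (i - j)"
  shows "inj_on (rigid_point \<theta>) {1..<2}"
proof (rule inj_onI)
  fix w v assume w: "w \<in> {1..<2}" and eq: "rigid_point \<theta> w = rigid_point \<theta> v"
  have "subsum \<theta> {i. w \<in> dyadic i} = subsum \<theta> {i. v \<in> dyadic i}"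
    using eq subsum_bounds(2)[of \<theta>, OF assms(1,2)]
    by (intro inj_onD[OF inj_on_cis_subset]) (simp_all add: rigid_point_def)
  then have "{i. w \<in> dyadic i} = {i. v \<in> dyadic i}"
    using injD[OF inj_subsum[of \<theta>, OF assms(1) subsum_bounds(1)[of \<theta>, OF assms(1,2)] assms(3)]]
    by blast
  then show "w = v"
    using dyadic_separates[OF w, of v] by blast
qed

text \<open>The mass of a point is the Lebesgue measure of its fibre, which is finite by injectivity
  and hence null.\<close>

lemma continuous_rigid_measure:
  assumes "\<And>i. 0 < \<theta> i" "\<And>i. \<theta> i \<le> (1/3) ^ i" "\<And>i j. j < i \<Longrightarrow> \<theta> i \<le> \<theta> j * (1/3) ^ (i - j)"
  shows "continuous_circle_measure (rigid_measure \<theta>)"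
  unfolding continuous_circle_measure_def
proof
  fix z :: complex assume z: "z \<in> unit_circle"
  let ?M = "restrict_space lborel {1..<2::real}" and ?X = "rigid_point \<theta> -` {z} \<inter> {1..<2}"
  have "{z} \<in> sets (restrict_space borel unit_circle)"
    using z by (subst sets_restrict_space_iff) auto
  then have eq: "measure (rigid_measure \<theta>) {z} = measure ?M ?X"
    unfolding rigid_measure_def
    by (simp add: measure_distr[OF measurable_rigid_point] space_restrict_space)
  have fin: "finite ?X"
    using inj_on_rigid_point[of \<theta>, OF assms] by (auto intro: finite_vimage_IntI)
  have "measure ?M ?X = measure lborel ?X"
    by (simp add: measure_restrict_space)
  also have "\<dots> = 0"
    using emeasure_lborel_countable[OF countable_finite[OF fin]] by (simp add: measure_def)
  finally show "measure (rigid_measure \<theta>) {z} = 0"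
    using eq by simp
qed

text \<open>Off \<open>dyadic i\<close> the angle \<open>\<theta> i\<close> is absent from the
  subset sum and the integrand is within \<open>\<gamma>\<close> of 1; on \<open>dyadic i\<close>
  the trivial bound 2 is used.\<close>

lemma fourier_coeff_rigid_measure_bound:
  assumes \<theta>: "\<And>i. 0 < \<theta> i" "\<And>i. \<theta> i \<le> (1/3) ^ i" and "0 \<le> \<gamma>"
    and bound: "\<And>S. finite S \<Longrightarrow> i \<notin> S \<Longrightarrow> (\<Sum>j\<in>S. cmod (cis (of_int N * \<theta> j) - 1)) \<le> \<gamma>"
  shows "cmod (fourier_coeff (rigid_measure \<theta>) N - 1) \<le> \<gamma> + 2 * measure lborel (dyadic i)"
proof -
  define M where "M = restrict_space lborel {1..<2::real}"
  interpret prob_space M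
    unfolding M_def by (rule prob_space_uniform)
  let ?f = "\<lambda>w. rigid_point \<theta> w powi N"
  have norm1: "cmod (?f w) = 1" for w
    by (simp add: rigid_point_def norm_power_int)
  have meas_pow: "(\<lambda>z. z powi N) \<in> borel_measurable (restrict_space borel unit_circle)"
    by (intro borel_measurable_continuous_on_restrict continuous_intros) auto
  then have f_meas: "?f \<in> borel_measurable M"
    unfolding M_def by (rule measurable_compose[OF measurable_rigid_point])
  have f_int: "integrable M ?f"
    by (rule integrable_const_bound[of _ 1]) (use f_meas norm1 in auto)
  have d: "dyadic i \<in> sets lborel"
    by (simp add: dyadic_eq)
  have dM: "dyadic i \<inter> {1..<2} \<in> sets M"
    using d unfolding M_def by (subst sets_restrict_space_iff) auto
  have "fourier_coeff (rigid_measure \<theta>) N = (\<integral>w. ?f w \<partial>M)"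
    unfolding fourier_coeff_def rigid_measure_def M_def
    by (rule integral_distr[OF measurable_rigid_point meas_pow])
  then have "fourier_coeff (rigid_measure \<theta>) N - 1 = (\<integral>w. ?f w - 1 \<partial>M)"
    using f_int by (simp add: prob_space)
  also have "cmod \<dots> \<le> (\<integral>w. cmod (?f w - 1) \<partial>M)"
    by (rule integral_norm_bound)
  also have "\<dots> \<le> (\<integral>w. \<gamma> + 2 * indicat_real (dyadic i \<inter> {1..<2}) w \<partial>M)"
  proof (rule integral_mono)
    show "integrable M (\<lambda>w. cmod (?f w - 1))"
      using f_int by simp
    show "integrable M (\<lambda>w. \<gamma> + 2 * indicat_real (dyadic i \<inter> {1..<2}) w)"
      using dM by (simp add: emeasure_eq_measure)
    fix w assume w: "w \<in> space M"
    show "cmod (?f w - 1) \<le> \<gamma> + 2 * indicat_real (dyadic i \<inter> {1..<2}) w"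
    proof (cases "w \<in> dyadic i")
      case True
      have "cmod (?f w - 1) \<le> 2"
        using norm_triangle_ineq4[of "?f w" 1] norm1[of w] by simp
      then show ?thesis
        using True w \<open>0 \<le> \<gamma>\<close> by (simp add: M_def space_restrict_space)
    next
      case False
      have "cmod (cis (of_int N * subsum \<theta> {j. w \<in> dyadic j}) - 1) \<le> \<gamma>"
        using \<theta>(1) subsum_bounds(1)[of \<theta>, OF \<theta>] False
        by (intro norm_cis_subsum_minus_one_le bound) (auto intro: less_imp_le)
      then show ?thesis
        using False by (simp add: rigid_point_def cis_power_int)
    qed
  qed
  also have "\<dots> = \<gamma> + 2 * measure M (dyadic i \<inter> {1..<2})"
    using dM by (simp add: prob_space emeasure_eq_measure)
  also have "measure M (dyadic i \<inter> {1..<2}) = measure lborel (dyadic i \<inter> {1..<2})"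
    unfolding M_def by (rule measure_restrict_space) auto
  also have "\<dots> \<le> measure lborel (dyadic i)"
    using d by (intro measure_mono_fmeasurable fmeasurableI)
      (auto simp: dyadic_eq divide_right_mono)
  finally show ?thesis by simp
qed

theorem corollary2p6:
  fixes m n :: "nat \<Rightarrow> int" and \<psi> :: "nat \<Rightarrow> nat"
  assumes "strict_mono m"
    and "strict_mono n"
    and "filterlim \<psi> at_top sequentially"
    and "unit_circle \<subseteq> closure (C_set m n \<psi>)"
  shows "\<exists>\<mu>. circle_prob_measure \<mu> \<and> continuous_circle_measure \<mu> \<and>
    tendsto_along (D_set \<psi>) (\<lambda>k k'. fourier_coeff \<mu> (m k * n k')) 1"
proof -
  let ?F = "\<lambda>k. (\<lambda>k'. m k * n k') ` {..\<psi> k}"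
  obtain \<theta> :: "nat \<Rightarrow> real" where \<theta>:
    "\<And>i. 0 < \<theta> i" "\<And>i. \<theta> i \<le> (1/3) ^ i" "\<And>i j. j < i \<Longrightarrow> \<theta> i \<le> \<theta> j * (1/3) ^ (i - j)"
    and rigid: "\<And>I \<gamma>. \<gamma> > 0 \<Longrightarrow> \<exists>k0. \<forall>k\<ge>k0. \<exists>i\<ge>I. \<forall>N\<in>?F k. \<forall>S. finite S \<longrightarrow> i \<notin> S \<longrightarrow>
       (\<Sum>j\<in>S. cmod (cis (of_int N * \<theta> j) - 1)) \<le> \<gamma>"
  proof (rule exists_almost_rigid_angles[of ?F])
    show "\<exists>\<^sub>F t in at_right 0. rigid_angle ?F t"
      by (rule frequently_rigid_angle) fact
  qed (auto intro: that)
  have "tendsto_along (D_set \<psi>) (\<lambda>k k'. fourier_coeff (rigid_measure \<theta>) (m k * n k')) 1"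
    unfolding tendsto_along_def
  proof (intro allI impI)
    fix \<gamma> :: real assume "\<gamma> > 0"
    \<comment> \<open>The budget is \<open>\<gamma> / 2\<close> for the controlled angles and
      \<open>2 * (\<gamma> / 4)\<close> for the exceptional interval, whose strict bound makes the
      total less than \<open>\<gamma>\<close>.\<close>
    then have "\<forall>\<^sub>F i in sequentially. measure lborel (dyadic i) < \<gamma> / 4"
      by (intro order_tendstoD(2)[OF measure_dyadic_tendsto_0]) simp
    then obtain I where I: "\<And>i. I \<le> i \<Longrightarrow> measure lborel (dyadic i) < \<gamma> / 4"
      unfolding eventually_sequentially by blast
    obtain k0 where k0: "\<And>k. k \<ge> k0 \<Longrightarrow> \<exists>i\<ge>I. \<forall>N\<in>?F k. \<forall>S. finite S \<longrightarrow> i \<notin> S \<longrightarrow>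
        (\<Sum>j\<in>S. cmod (cis (of_int N * \<theta> j) - 1)) \<le> \<gamma> / 2"
      using rigid[of "\<gamma> / 2" I] \<open>\<gamma> > 0\<close> by auto
    have "cmod (fourier_coeff (rigid_measure \<theta>) (m k * n k') - 1) < \<gamma>"
      if k: "k0 \<le> k" and kk': "(k, k') \<in> D_set \<psi>" for k k'
    proof -
      \<comment> \<open>The exceptional index depends on \<open>k\<close> alone, so the estimate is
        uniform in \<open>k'\<close>.\<close>
      obtain i where i: "I \<le> i" "\<forall>N\<in>?F k. \<forall>S. finite S \<longrightarrow> i \<notin> S \<longrightarrow>
          (\<Sum>j\<in>S. cmod (cis (of_int N * \<theta> j) - 1)) \<le> \<gamma> / 2"
        using k0[OF k] by blast
      have N: "m k * n k' \<in> ?F k"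
        using kk' by (auto simp: D_set_def)
      have "cmod (fourier_coeff (rigid_measure \<theta>) (m k * n k') - 1) \<le> \<gamma> / 2 + 2 * measure lborel (dyadic i)"
      proof (rule fourier_coeff_rigid_measure_bound[OF \<theta>(1,2)])
        show "0 \<le> \<gamma> / 2"
          using \<open>\<gamma> > 0\<close> by simp
        show "(\<Sum>j\<in>S. cmod (cis (of_int (m k * n k') * \<theta> j) - 1)) \<le> \<gamma> / 2"
          if "finite S" "i \<notin> S" for S
          using i(2)[rule_format, OF N that] .
      qed
      then show ?thesis
        using I[OF i(1)] by linarith
    qed
    then show "\<exists>k0. \<forall>k k'. (k, k') \<in> D_set \<psi> \<and> k0 \<le> k \<longrightarrow>
        cmod (fourier_coeff (rigid_measure \<theta>) (m k * n k') - 1) < \<gamma>"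
      by blast
  qed
  then show ?thesis
    using circle_prob_measure_rigid_measure continuous_rigid_measure[of \<theta>, OF \<theta>] by blast
qed

end
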